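(* Let $G=(V,E,\vartheta,w)$ be a connected, locally finite, stochastically complete weighted graph with $D^{\epsilon}_{\vartheta}<\infty$, $\vartheta_{\max}<\infty$, $\omega_{\min}>0$, where $\epsilon\in(0,1)$. Let $b$ and $\gamma$ satisfy $|b(x,t)|\le C_0$ and $\gamma(t)\le c_1+\frac{c_2}{t}$ for constants $C_0,c_1,c_2\in\mathbb{R}$. Let $n$ be the dimensional constant of the heat kernel estimate for the equation $\Delta^{\epsilon}u-b(x,t)u=u_t+\gamma(t)u$ (as described in the context). Then there are constants $C_4,C_5,C_6>0$ depending on $D^{\epsilon}_{\vartheta}$, $\omega_{\min}$ and $\vartheta_{\max}$ such that for all $x\in V$ and $r>0$, $$\mathrm{vol}(B(x,r))\le C_6\cdot r^{2n}\exp\left(C_4r^2+C_5\right).$$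
   Context: $G=(V,E,\vartheta,w)$ is a graph with vertex set $V$, edge set $E$, vertex measure $\vartheta:V\to(0,\infty)$ and symmetric edge weights $w_{xy}=w_{yx}>0$ if $x\sim y$ (adjacent), $w_{xy}=0$ otherwise. Locally finite: every vertex has finitely many neighbors. The distance $d(x,y)$ is the number of edges of a shortest path from $x$ to $y$; $B(x,r)=\{z\in V: d(x,z)\le r\}$ is the geodesic ball and $\mathrm{vol}(U)=\sum_{z\in U}\vartheta(z)$. Let $p_t(x,y)$ be the heat kernel of $G$ (associated with $\Delta f(x)=\frac{1}{\vartheta(x)}\sum_{y\sim x}w_{xy}(f(y)-f(x))$). $G$ is stochastically complete if $\sum_{y\in V}p_t(x,y)\vartheta(y)=1$ for all $t>0$, $x\in V$. For $\epsilon\in(0,1)$ and $x\ne y$, $W_{\epsilon}(x,y)=\frac{\epsilon}{\Gamma(1-\epsilon)}\vartheta(x)\vartheta(y)\int_0^{\infty}p_t(x,y)t^{-1-\epsilon}\,dt$, where $\Gamma(1-\epsilon)$ is the Gamma function. For $f:V\to\mathbb{R}$, $$\Delta^{\epsilon}f(x)=\frac{1}{\vartheta(x)}\sum_{y\in V,\,y\ne x}W_{\epsilon}(x,y)(f(y)-f(x)).$$ Constants: $D^{\epsilon}_{\vartheta}:=\max_{x\in V}\frac{\sum_{y\ne x}W_{\epsilon}(x,y)}{\vartheta(x)}$, $\vartheta_{\max}:=\sup_{x\in V}\vartheta(x)$, $\omega_{\min}:=\inf_{x,y\in V,\,x\ne y}W_{\epsilon}(x,y)$. $u_t$ is the time derivative.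 The dimensional constant $n$: let $P_t(x,y)$ be the heat kernel (fundamental solution) of $\Delta^{\epsilon}u-b(x,t)u=u_t+\gamma(t)u$. Then $n$ is a constant for which, with some constants $C_1,C_2,C_3>0$ depending on $D^{\epsilon}_{\vartheta},\omega_{\min},\vartheta_{\max}$, one has for all $t>1$ and $x,y\in V$ $$\frac{C_3}{t^{n}}\exp\left\{-(2D^{\epsilon}_{\vartheta}+C_0+c_1)(t-1)-\frac{4\vartheta_{\max}d(x,y)^2}{\omega_{\min}(t-1)}\right\}\le P_t(x,y)\le\frac{C_1e^{C_2t}}{\mathrm{vol}(B(x,\sqrt t))}.$$
   Formalization: For n > 0 the bound cannot hold for all r > 0, as its right side tends to 0 when r → 0 while vol(B(x,r)) ≥ ϑ(x) > 0; it is proved for all r ≥ ρ, with any fixed ρ > 0 on which the constants may also depend. For n ≤ 0 all r > 0 are covered. *)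

theory Defs
  imports "HOL-Analysis.Analysis"
begin

section \<open>Weighted graphs\<close>

record 'v wgraph =
  verts :: "'v set"
  adj :: "'v \<Rightarrow> 'v \<Rightarrow> bool"
  vmeasure :: "'v \<Rightarrow> real"
  weight :: "'v \<Rightarrow> 'v \<Rightarrow> real"

definition weighted_graph :: "'v wgraph \<Rightarrow> bool" where
  "weighted_graph G \<longleftrightarrow>
     (\<forall>x y. adj G x y \<longrightarrow> x \<in> verts G \<and> y \<in> verts G) \<and>
     (\<forall>x y. adj G x y \<longrightarrow> adj G y x) \<and>
     (\<forall>x\<in>verts G. 0 < vmeasure G x) \<and>
     (\<forall>x\<in>verts G. \<forall>y\<in>verts G. weight G x y = weight G y x) \<and>
     (\<forall>x\<in>verts G. \<forall>y\<in>verts G. if adj G x y then 0 < weight G x y else weight G x y = 0)"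

definition locally_finite_graph :: "'v wgraph \<Rightarrow> bool" where
  "locally_finite_graph G \<longleftrightarrow> (\<forall>x\<in>verts G. finite {y. adj G x y})"

definition connected_graph :: "'v wgraph \<Rightarrow> bool" where
  "connected_graph G \<longleftrightarrow> (\<forall>x\<in>verts G. \<forall>y\<in>verts G. (x, y) \<in> {(a, b). adj G a b}\<^sup>*)"

definition gdist :: "'v wgraph \<Rightarrow> 'v \<Rightarrow> 'v \<Rightarrow> nat" where
  "gdist G x y = (LEAST k. (x, y) \<in> {(a, b). adj G a b} ^^ k)"

definition gball :: "'v wgraph \<Rightarrow> 'v \<Rightarrow> real \<Rightarrow> 'v set" where
  "gball G x r = {z \<in> verts G. real (gdist G x z) \<le> r}"

text \<open>Only applied to balls, which are finite in a connected locally finite graph.\<close>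

definition vol :: "'v wgraph \<Rightarrow> 'v set \<Rightarrow> real" where
  "vol G U = (\<Sum>z\<in>U. vmeasure G z)"


section \<open>The heat kernel of the graph\<close>

definition laplacian :: "'v wgraph \<Rightarrow> ('v \<Rightarrow> real) \<Rightarrow> 'v \<Rightarrow> real" where
  "laplacian G f x = (\<Sum>y\<in>{y. adj G x y}. weight G x y * (f y - f x)) / vmeasure G x"

definition dirichlet_laplacian ::
    "'v wgraph \<Rightarrow> 'v set \<Rightarrow> ('v \<Rightarrow> real) \<Rightarrow> 'v \<Rightarrow> real" where
  "dirichlet_laplacian G U f x =
     (if x \<in> U then laplacian G (\<lambda>z. if z \<in> U then f z else 0) x else 0)"

text \<open>The kernel of the semigroup \<open>exp (t \<Delta>\<^sub>U)\<close> with respect to the vertex measure, for a finite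
  set \<open>U\<close> of vertices; it vanishes unless both arguments lie in \<open>U\<close>.\<close>

definition dirichlet_heat_kernel ::
    "'v wgraph \<Rightarrow> 'v set \<Rightarrow> real \<Rightarrow> 'v \<Rightarrow> 'v \<Rightarrow> real" where
  "dirichlet_heat_kernel G U t x y =
     (\<Sum>k. t ^ k / fact k * (dirichlet_laplacian G U ^^ k) (indicator ({y} \<inter> U)) x)
       / vmeasure G y"

text \<open>The (minimal) heat kernel as the limit of the Dirichlet heat kernels along an exhaustion by
  finite sets. These increase with \<open>U\<close> and are bounded by the reciprocal of the measure of \<open>y\<close>,
  so the limit is a supremum.\<close>

definition heat_kernel :: "'v wgraph \<Rightarrow> real \<Rightarrow> 'v \<Rightarrow> 'v \<Rightarrow> real" where
  "heat_kernel G t x y =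
     (SUP U\<in>{U. finite U \<and> U \<subseteq> verts G}. dirichlet_heat_kernel G U t x y)"

definition stochastically_complete :: "'v wgraph \<Rightarrow> bool" where
  "stochastically_complete G \<longleftrightarrow>
     (\<forall>t>0. \<forall>x\<in>verts G. ((\<lambda>y. heat_kernel G t x y * vmeasure G y) has_sum 1) (verts G))"


section \<open>The fractional Laplacian\<close>

text \<open>For \<open>x \<noteq> y\<close> the integral converges: the heat kernel is bounded in \<open>t\<close> and \<open>O(t)\<close> at 0.\<close>

definition frac_weight :: "'v wgraph \<Rightarrow> real \<Rightarrow> 'v \<Rightarrow> 'v \<Rightarrow> real" where
  "frac_weight G \<epsilon> x y =
     \<epsilon> / Gamma (1 - \<epsilon>) * vmeasure G x * vmeasure G y *
       (LBINT t:{0<..}. heat_kernel G t x y * t powr (- 1 - \<epsilon>))"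

definition frac_laplacian :: "'v wgraph \<Rightarrow> real \<Rightarrow> ('v \<Rightarrow> real) \<Rightarrow> 'v \<Rightarrow> real" where
  "frac_laplacian G \<epsilon> f x =
     (\<Sum>\<^sub>\<infinity>y\<in>verts G - {x}. frac_weight G \<epsilon> x y * (f y - f x)) / vmeasure G x"

text \<open>The three constants are extended nonnegative reals, so that finiteness is a meaningful
  hypothesis. On a graph with a single vertex the infimum in \<open>omega_min\<close> is infinite.\<close>

definition D_frac :: "'v wgraph \<Rightarrow> real \<Rightarrow> ennreal" where
  "D_frac G \<epsilon> =
     (SUP x\<in>verts G. (\<Sum>\<^sub>\<infinity>y\<in>verts G - {x}. ennreal (frac_weight G \<epsilon> x y)) / ennreal (vmeasure G x))"

definition theta_max :: "'v wgraph \<Rightarrow> ennreal" where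
  "theta_max G = (SUP x\<in>verts G. ennreal (vmeasure G x))"

definition omega_min :: "'v wgraph \<Rightarrow> real \<Rightarrow> ennreal" where
  "omega_min G \<epsilon> =
     (INF (x, y)\<in>{(x, y). x \<in> verts G \<and> y \<in> verts G \<and> x \<noteq> y}. ennreal (frac_weight G \<epsilon> x y))"


section \<open>The parabolic equation and its heat kernel\<close>

definition solves_equation ::
    "'v wgraph \<Rightarrow> real \<Rightarrow> ('v \<Rightarrow> real \<Rightarrow> real) \<Rightarrow> (real \<Rightarrow> real) \<Rightarrow> (real \<Rightarrow> 'v \<Rightarrow> real) \<Rightarrow> bool" where
  "solves_equation G \<epsilon> b \<gamma> u \<longleftrightarrow>
     (\<forall>x\<in>verts G. \<forall>t>0.
        (\<lambda>y. frac_weight G \<epsilon> x y * (u t y - u t x)) summable_on (verts G - {x}) \<and>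
        (\<exists>u'. ((\<lambda>s. u s x) has_real_derivative u') (at t) \<and>
              frac_laplacian G \<epsilon> (u t) x - b x t * u t x = u' + \<gamma> t * u t x))"

definition fundamental_solution ::
    "'v wgraph \<Rightarrow> real \<Rightarrow> ('v \<Rightarrow> real \<Rightarrow> real) \<Rightarrow> (real \<Rightarrow> real) \<Rightarrow>
     (real \<Rightarrow> 'v \<Rightarrow> 'v \<Rightarrow> real) \<Rightarrow> bool" where
  "fundamental_solution G \<epsilon> b \<gamma> P \<longleftrightarrow>
     (\<forall>u0 :: 'v \<Rightarrow> real. bounded (u0 ` verts G) \<longrightarrow>
        (\<forall>t>0. \<forall>x\<in>verts G. (\<lambda>y. P t x y * vmeasure G y * u0 y) summable_on verts G) \<and>
        (let u = (\<lambda>t x. \<Sum>\<^sub>\<infinity>y\<in>verts G. P t x y * vmeasure G y * u0 y) in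
           solves_equation G \<epsilon> b \<gamma> u \<and>
           (\<forall>x\<in>verts G. ((\<lambda>t. u t x) \<longlongrightarrow> u0 x) (at_right 0))))"

text \<open>The two-sided bound that singles out the dimensional constant \<open>n\<close>. On a graph with a single
  vertex the infinite \<open>omega_min\<close> is converted to 0, but there the distance is 0 and the
  corresponding term vanishes, as it should.\<close>

definition heat_kernel_estimate ::
    "'v wgraph \<Rightarrow> real \<Rightarrow> real \<Rightarrow> real \<Rightarrow> (real \<Rightarrow> 'v \<Rightarrow> 'v \<Rightarrow> real) \<Rightarrow>
     real \<Rightarrow> real \<Rightarrow> real \<Rightarrow> real \<Rightarrow> bool" where
  "heat_kernel_estimate G \<epsilon> C0 c1 P n C1 C2 C3 \<longleftrightarrow>
     (\<forall>t>1. \<forall>x\<in>verts G. \<forall>y\<in>verts G.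
        C3 / t powr n *
          exp (- (2 * enn2real (D_frac G \<epsilon>) + C0 + c1) * (t - 1)
               - 4 * enn2real (theta_max G) * (real (gdist G x y))\<^sup>2
                   / (enn2real (omega_min G \<epsilon>) * (t - 1)))
          \<le> P t x y \<and>
        P t x y \<le> C1 * exp (C2 * t) / vol G (gball G x (sqrt t)))"

end

theory Submission
  imports Defs
begin

text \<open>On the diagonal the Gaussian factor of the lower heat kernel bound equals 1, so for every
  \<open>t > 1\<close> the two bounds for \<open>P t x x\<close> read
  \<open>C3 / t powr n * exp (- A * (t - 1)) \<le> C1 * exp (C2 * t) / vol (B(x, \<surd>t))\<close> with
  \<open>A = 2 D + C0 + c1\<close>. Solving for the volume bounds the volume of the ball of radius \<open>\<surd>t\<close> by
  \<open>C1 / C3 * t powr n * exp (C2 * t + A * (t - 1))\<close> (lemma \<open>vol_gball_sqrt_le\<close>), and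
  \<open>t = r\<^sup>2\<close> gives the claim for all \<open>r > 1\<close>.

  The estimate says nothing about times \<open>t \<le> 1\<close>, but the distance takes integer values: the
  ball of radius 1 is also the ball of radius \<open>\<surd>2\<close>, to which the case \<open>t = 2\<close> applies, and a ball
  of radius \<open>r < 1\<close> is a single vertex, whose measure is at most \<open>theta_max\<close>. For \<open>r \<le> 1\<close> a
  constant bound is thus available, and it remains to bound \<open>r powr (2 * n)\<close> from below there; this
  is where the lower bound \<open>\<rho>\<close> on the radius enters when \<open>n\<close> is positive.\<close>

section \<open>Balls of small radius\<close>

lemma gdist_self [simp]: "gdist G x x = 0"
  unfolding gdist_def by (rule Least_eq_0) simp

lemma gdist_eq_0_iff:
  assumes "connected_graph G" and "x \<in> verts G" and "z \<in> verts G"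
  shows "gdist G x z = 0 \<longleftrightarrow> x = z"
proof
  assume zero: "gdist G x z = 0"
  \<comment> \<open>Connectedness makes the set of walk lengths nonempty; only then is the least
    element attained.\<close>
  obtain k where "(x, z) \<in> {(a, b). adj G a b} ^^ k"
    using assms unfolding connected_graph_def by (meson rtrancl_imp_relpow)
  then have "(x, z) \<in> {(a, b). adj G a b} ^^ gdist G x z"
    unfolding gdist_def by (rule LeastI)
  with zero show "x = z" by simp
qed simp

lemma gball_eq_singleton:
  assumes "connected_graph G" and "x \<in> verts G" and "0 \<le> r" and "r < 1"
  shows "gball G x r = {x}"
proof -
  have "real (gdist G x z) \<le> r \<longleftrightarrow> x = z" if "z \<in> verts G" for z
  proof -
    have "real (gdist G x z) \<le> r \<longleftrightarrow> gdist G x z = 0"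
      using assms(3,4) by (cases "gdist G x z") auto
    with gdist_eq_0_iff[OF assms(1,2) that] show ?thesis by simp
  qed
  then show ?thesis
    using assms(2) unfolding gball_def by auto
qed

lemma gball_sqrt_2: "gball G x (sqrt 2) = gball G x 1"
proof -
  have "real k \<le> sqrt 2 \<longleftrightarrow> real k \<le> 1" for k :: nat
  proof
    assume "real k \<le> sqrt 2"
    also have "sqrt 2 < sqrt 4" by (rule real_sqrt_less_mono) simp
    finally show "real k \<le> 1" by simp
  next
    assume "real k \<le> 1"
    also have "1 \<le> sqrt (2 :: real)" by simp
    finally show "real k \<le> sqrt 2" .
  qed
  then show ?thesis unfolding gball_def by simp
qed

lemma vmeasure_le_theta_max:
  assumes "x \<in> verts G" and "theta_max G < \<infinity>"
  shows "vmeasure G x \<le> enn2real (theta_max G)"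
proof (cases "0 \<le> vmeasure G x")
  case True
  have "ennreal (vmeasure G x) \<le> theta_max G"
    unfolding theta_max_def using assms(1) by (rule SUP_upper)
  then have "enn2real (ennreal (vmeasure G x)) \<le> enn2real (theta_max G)"
    using assms(2) by (intro enn2real_mono) auto
  with True show ?thesis by simp
next
  case False
  then show ?thesis using enn2real_nonneg[of "theta_max G"] by linarith
qed

lemma vol_nonneg:
  assumes "weighted_graph G" and "U \<subseteq> verts G"
  shows "0 \<le> vol G U"
  unfolding vol_def using assms
  by (intro sum_nonneg) (auto simp: weighted_graph_def intro: less_imp_le)


section \<open>Volume growth from the diagonal heat kernel estimate\<close>

text \<open>The lower and the upper bound for \<open>P t x x\<close> must be compatible; since the volume stands in
  the denominator of the upper one, this bounds it from above.\<close>

lemma vol_gball_sqrt_le: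
  assumes "weighted_graph G" and "heat_kernel_estimate G \<epsilon> C0 c1 P n C1 C2 C3"
    and "0 < C1" and "0 < C3" and "1 < t" and "x \<in> verts G"
  shows "vol G (gball G x (sqrt t))
    \<le> C1 / C3 * t powr n *
       exp (C2 * t + (2 * enn2real (D_frac G \<epsilon>) + C0 + c1) * (t - 1))"
proof -
  define A where "A = 2 * enn2real (D_frac G \<epsilon>) + C0 + c1"
  define v where "v = vol G (gball G x (sqrt t))"
  have "0 \<le> v"
    unfolding v_def using assms(1) by (rule vol_nonneg) (auto simp: gball_def)
  have diagonal: "C3 / t powr n * exp (- A * (t - 1)) \<le> C1 * exp (C2 * t) / v"
    using assms(2,5,6) unfolding heat_kernel_estimate_def A_def v_def by fastforce
  \<comment> \<open>The case \<open>v = 0\<close> also covers infinite balls, on which \<open>vol\<close> takes its default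
    value 0.\<close>
  have "v \<le> C1 / C3 * t powr n * exp (C2 * t + A * (t - 1))"
  proof (cases "v = 0")
    case True
    then show ?thesis using assms(3,4) by simp
  next
    case False
    with \<open>0 \<le> v\<close> have "0 < v" by simp
    have "0 < t powr n" using assms(5) by simp
    have "exp (- A * (t - 1)) * exp (A * (t - 1)) = 1"
      by (simp flip: exp_add)
    then have "v = v * (exp (- A * (t - 1)) * exp (A * (t - 1)))"
      by (simp only: mult_1_right)
    also have "\<dots> = (C3 / t powr n * exp (- A * (t - 1)) * v) *
        (t powr n / C3 * exp (A * (t - 1)))"
      using assms(4) \<open>0 < t powr n\<close> by simp
    also have "\<dots> \<le> (C1 * exp (C2 * t)) * (t powr n / C3 * exp (A * (t - 1)))"
      using diagonal \<open>0 < v\<close> assms(4) by (intro mult_right_mono) (simp_all add: field_simps)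
    also have "\<dots> = C1 / C3 * t powr n * exp (C2 * t + A * (t - 1))"
      by (simp add: exp_add)
    finally show ?thesis .
  qed
  then show ?thesis unfolding A_def v_def .
qed

text \<open>For nonpositive \<open>n\<close> the power \<open>r powr (2 * n)\<close> is at least 1 on \<open>r \<le> 1\<close>; for positive \<open>n\<close> it
  decreases to 0 with \<open>r\<close>, and its value at \<open>\<rho>\<close> is the best lower bound.\<close>

lemma powr_ge_on_unit_interval:
  fixes r \<rho> n :: real
  assumes "0 < r" and "r \<le> 1" and "0 \<le> \<rho>" and "\<rho> \<le> r"
  shows "(if 0 < n then \<rho> powr (2 * n) else 1) \<le> r powr (2 * n)"
proof (cases "0 < n")
  case True
  then show ?thesis using assms by (simp add: powr_mono2)
next
  case False
  then have "r powr 0 \<le> r powr (2 * n)"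
    using assms by (intro powr_mono') auto
  with False assms(1) show ?thesis by simp
qed

(* C1, ..., C6 are functions of (D_frac, omega_min, theta_max): this is the dependence of the
   constants. The bound is asserted for the radii r > 0 with r \<ge> \<rho>. If n \<le> 0 then \<rho> = 0 is
   allowed, so that all r > 0 are covered by the same constants. If n > 0 this is impossible, since
   the right-hand side tends to 0 as r tends to 0, whereas the ball always contains x; then \<rho> is
   an arbitrary positive number. *)

theorem corollary5p2:
  fixes \<epsilon> C0 c1 c2 n \<rho> :: real
    and C1 C2 C3 :: "ennreal \<Rightarrow> ennreal \<Rightarrow> ennreal \<Rightarrow> real"
  assumes "0 < \<epsilon>" and "\<epsilon> < 1"
    and "\<forall>D \<omega> \<theta>. 0 < C1 D \<omega> \<theta> \<and> 0 < C2 D \<omega> \<theta> \<and> 0 < C3 D \<omega> \<theta>"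
    and "0 \<le> \<rho>" and "0 < n \<longrightarrow> 0 < \<rho>"
  shows "\<exists>C4 C5 C6 :: ennreal \<Rightarrow> ennreal \<Rightarrow> ennreal \<Rightarrow> real.
    (\<forall>D \<omega> \<theta>. 0 < C4 D \<omega> \<theta> \<and> 0 < C5 D \<omega> \<theta> \<and> 0 < C6 D \<omega> \<theta>) \<and>
    (\<forall>(G :: 'v wgraph) (b :: 'v \<Rightarrow> real \<Rightarrow> real) (\<gamma> :: real \<Rightarrow> real)
        (P :: real \<Rightarrow> 'v \<Rightarrow> 'v \<Rightarrow> real) D \<omega> \<theta>.
       weighted_graph G \<and> connected_graph G \<and> locally_finite_graph G \<and>
       stochastically_complete G \<and>
       D = D_frac G \<epsilon> \<and> \<omega> = omega_min G \<epsilon> \<and> \<theta> = theta_max G \<and>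
       D < \<infinity> \<and> \<theta> < \<infinity> \<and> 0 < \<omega> \<and>
       (\<forall>x\<in>verts G. \<forall>t>0. \<bar>b x t\<bar> \<le> C0) \<and>
       (\<forall>t>0. \<gamma> t \<le> c1 + c2 / t) \<and>
       fundamental_solution G \<epsilon> b \<gamma> P \<and>
       heat_kernel_estimate G \<epsilon> C0 c1 P n (C1 D \<omega> \<theta>) (C2 D \<omega> \<theta>) (C3 D \<omega> \<theta>) \<longrightarrow>
       (\<forall>x\<in>verts G. \<forall>r>0. \<rho> \<le> r \<longrightarrow>
          vol G (gball G x r)
            \<le> C6 D \<omega> \<theta> * r powr (2 * n) * exp (C4 D \<omega> \<theta> * r\<^sup>2 + C5 D \<omega> \<theta>)))"
proof -
  define A where "A D = \<bar>2 * enn2real D + C0 + c1\<bar>" for D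
  define m where "m = (if 0 < n then \<rho> powr (2 * n) else 1)"
  define K where "K D \<omega> \<theta> = C1 D \<omega> \<theta> / C3 D \<omega> \<theta>" for D \<omega> \<theta>
  \<comment> \<open>\<open>B\<close> bounds the volume of every ball of radius at most 1, up to the factor
    \<open>exp (C5 D \<omega> \<theta>)\<close>: the summand \<open>enn2real \<theta>\<close> is for the balls that consist of one vertex, and
    \<open>2 powr n * K\<close> is for the radius 1.\<close>
  define B where "B D \<omega> \<theta> = enn2real \<theta> + 2 powr n * K D \<omega> \<theta>" for D \<omega> \<theta>
  define C4 where "C4 D \<omega> \<theta> = C2 D \<omega> \<theta> + A D" for D \<omega> \<theta>
  define C5 where "C5 D \<omega> \<theta> = 2 * C2 D \<omega> \<theta> + A D" for D \<omega> \<theta>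
  define C6 where "C6 D \<omega> \<theta> = K D \<omega> \<theta> + B D \<omega> \<theta> / m" for D \<omega> \<theta>
  have "0 < m" using assms(5) by (auto simp: m_def)
  have "0 \<le> A D" for D by (simp add: A_def)
  have "0 < C2 D \<omega> \<theta>" for D \<omega> \<theta> using assms(3) by simp
  have "0 < K D \<omega> \<theta>" for D \<omega> \<theta> using assms(3) by (simp add: K_def)
  then have "0 < B D \<omega> \<theta>" for D \<omega> \<theta>
    unfolding B_def by (intro add_nonneg_pos mult_pos_pos) auto
  have "0 < C4 D \<omega> \<theta>" and "0 < C5 D \<omega> \<theta>" for D \<omega> \<theta>
    using \<open>0 < C2 D \<omega> \<theta>\<close> \<open>0 \<le> A D\<close> by (simp_all add: C4_def C5_def)
  have "0 < C6 D \<omega> \<theta>" for D \<omega> \<theta>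
    using \<open>0 < K D \<omega> \<theta>\<close> \<open>0 < B D \<omega> \<theta>\<close> \<open>0 < m\<close> by (simp add: C6_def add_pos_pos)

  have bound: "vol G (gball G x r)
      \<le> C6 D \<omega> \<theta> * r powr (2 * n) * exp (C4 D \<omega> \<theta> * r\<^sup>2 + C5 D \<omega> \<theta>)"
    if wg: "weighted_graph G" and conn: "connected_graph G"
      and D: "D = D_frac G \<epsilon>" and \<theta>: "\<theta> = theta_max G" and fin: "\<theta> < \<infinity>"
      and est: "heat_kernel_estimate G \<epsilon> C0 c1 P n (C1 D \<omega> \<theta>) (C2 D \<omega> \<theta>) (C3 D \<omega> \<theta>)"
      and x: "x \<in> verts G" and "0 < r" and "\<rho> \<le> r"
    for G :: "'v wgraph" and P D \<omega> \<theta> x r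
  proof -
    have growth: "vol G (gball G x (sqrt t))
        \<le> K D \<omega> \<theta> * t powr n * exp (C2 D \<omega> \<theta> * t + A D * (t - 1))" if "1 < t" for t
    proof -
      have "vol G (gball G x (sqrt t)) \<le> K D \<omega> \<theta> * t powr n *
          exp (C2 D \<omega> \<theta> * t + (2 * enn2real D + C0 + c1) * (t - 1))"
        unfolding K_def D using vol_gball_sqrt_le[OF wg est _ _ that x] assms(3) D by simp
      also have "\<dots> \<le> K D \<omega> \<theta> * t powr n * exp (C2 D \<omega> \<theta> * t + A D * (t - 1))"
        using that \<open>0 < K D \<omega> \<theta>\<close>
        by (intro mult_left_mono) (auto simp: A_def intro!: mult_right_mono)
      finally show ?thesis .
    qed
    show ?thesis
    proof (cases "1 < r")
      case True
      have "1 < r\<^sup>2" using True by (simp add: one_less_power)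
      have "(r\<^sup>2) powr n = r powr (2 * n)"
        using \<open>0 < r\<close> by (simp add: powr_powr flip: powr_numeral)
      then have "vol G (gball G x r)
          \<le> K D \<omega> \<theta> * r powr (2 * n) * exp (C2 D \<omega> \<theta> * r\<^sup>2 + A D * (r\<^sup>2 - 1))"
        using growth[OF \<open>1 < r\<^sup>2\<close>] \<open>0 < r\<close> by simp
      also have "\<dots> \<le> C6 D \<omega> \<theta> * r powr (2 * n) * exp (C4 D \<omega> \<theta> * r\<^sup>2 + C5 D \<omega> \<theta>)"
      proof (intro mult_mono)
        show "K D \<omega> \<theta> \<le> C6 D \<omega> \<theta>"
          using \<open>0 < B D \<omega> \<theta>\<close> \<open>0 < m\<close> by (simp add: C6_def)
        show "exp (C2 D \<omega> \<theta> * r\<^sup>2 + A D * (r\<^sup>2 - 1)) \<le> exp (C4 D \<omega> \<theta> * r\<^sup>2 + C5 D \<omega> \<theta>)"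
          using \<open>0 < C2 D \<omega> \<theta>\<close> \<open>0 \<le> A D\<close> by (simp add: C4_def C5_def algebra_simps)
      qed (use \<open>0 < C6 D \<omega> \<theta>\<close> in auto)
      finally show ?thesis .
    next
      case False
      have "vol G (gball G x r) \<le> B D \<omega> \<theta> * exp (C5 D \<omega> \<theta>)"
      proof (cases "r = 1")
        case True
        have "vol G (gball G x r) \<le> (2 powr n * K D \<omega> \<theta>) * exp (C5 D \<omega> \<theta>)"
          using growth[of 2] True by (simp add: gball_sqrt_2 C5_def mult.commute)
        also have "\<dots> \<le> B D \<omega> \<theta> * exp (C5 D \<omega> \<theta>)"
          by (intro mult_right_mono) (simp_all add: B_def)
        finally show ?thesis .
      next
        case False
        then have "gball G x r = {x}"
          using gball_eq_singleton[OF conn x] \<open>0 < r\<close> \<open>\<not> 1 < r\<close> by simp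
        then have "vol G (gball G x r) \<le> enn2real \<theta>"
          using vmeasure_le_theta_max[OF x] fin \<theta> by (simp add: vol_def)
        also have "\<dots> \<le> B D \<omega> \<theta>"
          using \<open>0 < K D \<omega> \<theta>\<close> by (simp add: B_def)
        also have "\<dots> \<le> B D \<omega> \<theta> * exp (C5 D \<omega> \<theta>)"
          using \<open>0 < B D \<omega> \<theta>\<close> \<open>0 < C5 D \<omega> \<theta>\<close> by simp
        finally show ?thesis .
      qed
      also have "\<dots> = B D \<omega> \<theta> / m * m * exp (C5 D \<omega> \<theta>)"
        using \<open>0 < m\<close> by simp
      also have "\<dots> \<le> C6 D \<omega> \<theta> * r powr (2 * n) * exp (C4 D \<omega> \<theta> * r\<^sup>2 + C5 D \<omega> \<theta>)"
      proof (intro mult_mono)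
        show "m \<le> r powr (2 * n)"
          unfolding m_def using \<open>0 < r\<close> \<open>\<not> 1 < r\<close> \<open>0 \<le> \<rho>\<close> \<open>\<rho> \<le> r\<close>
          by (intro powr_ge_on_unit_interval) auto
        show "B D \<omega> \<theta> / m \<le> C6 D \<omega> \<theta>"
          using \<open>0 < K D \<omega> \<theta>\<close> by (simp add: C6_def)
        show "exp (C5 D \<omega> \<theta>) \<le> exp (C4 D \<omega> \<theta> * r\<^sup>2 + C5 D \<omega> \<theta>)"
          using \<open>0 < C4 D \<omega> \<theta>\<close> by simp
      qed (use \<open>0 < C6 D \<omega> \<theta>\<close> \<open>0 < m\<close> in auto)
      finally show ?thesis .
    qed
  qed
  show ?thesis
  proof (rule exI[of _ C4], rule exI[of _ C5], rule exI[of _ C6], intro conjI allI)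
    show "0 < C4 D \<omega> \<theta>" "0 < C5 D \<omega> \<theta>" "0 < C6 D \<omega> \<theta>" for D \<omega> \<theta> by fact+
  qed (intro impI ballI allI, elim conjE, rule bound, assumption+)
qed

end
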